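(* Let $\mathcal{T}$ be the set of probability densities on $\mathbb{R}^d$ with respect to Lebesgue measure, endowed with the $L^1$ norm $\|\cdot\|_1$. (i) If $f\in\mathcal{T}$ satisfies $\mathrm{reach}(\mathrm{supp}(f))>0$, then for every $\delta>0$ there exists $f_\delta\in\mathcal{T}$ with $\|f-f_\delta\|_1<\delta$ and $\mathrm{reach}(\mathrm{supp}(f_\delta))=0$. (ii) If $f\in\mathcal{T}$ satisfies $\mathrm{reach}(\mathrm{supp}(f))=0$, then for every $\varepsilon>0$ there exists $f_\varepsilon\in\mathcal{T}$ with $\|f-f_\varepsilon\|_1<\varepsilon$ and $\mathrm{reach}(\mathrm{supp}(f_\varepsilon))>0$. Consequently the functional $\alpha:\mathcal{T}\to\{0,1\}$, $\alpha(f)=1$ if $\mathrm{reach}(\mathrm{supp}(f))=0$ and $\alpha(f)=0$ otherwise, is discontinuous (in $\|\cdot\|_1$) at every $f\in\mathcal{T}$, and therefore $\alpha$ is not consistently estimable on $\mathcal{T}$ from i.i.d. samples.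
   Context: $\mathrm{supp}(f)$ is the support of the density $f$. For a set $M\subset\mathbb{R}^d$, $\mathrm{Unp}(M)$ is the set of points of $\mathbb{R}^d$ having a unique closest point in $M$; for $x\in M$, $\mathrm{reach}(M,x)=\sup\{r>0:\mathring{\mathcal{B}}(x,r)\subset\mathrm{Unp}(M)\}$ with $\mathring{\mathcal{B}}$ the open Euclidean ball, and $\mathrm{reach}(M)=\inf_{x\in M}\mathrm{reach}(M,x)$. A functional $\Phi$ on $\mathcal{T}$ is consistently estimable if there exist estimators $T_n=T_n(X_1,\dots,X_n)$ such that for every $f\in\mathcal{T}$, $T_n\to\Phi(f)$ in probability when $X_1,X_2,\dots$ are i.i.d. with density $f$. *)

theory Defs
  imports "HOL-Probability.Probability"
begin

definition is_density :: "('a::euclidean_space \<Rightarrow> real) \<Rightarrow> bool" where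
  "is_density f \<longleftrightarrow> f \<in> borel_measurable lborel \<and> (\<forall>x. 0 \<le> f x) \<and>
     integrable lborel f \<and> integral\<^sup>L lborel f = 1"

definition L1_dist :: "('a::euclidean_space \<Rightarrow> real) \<Rightarrow> ('a \<Rightarrow> real) \<Rightarrow> real" where
  "L1_dist f g = (\<integral>x. \<bar>f x - g x\<bar> \<partial>lborel)"

definition dsupp :: "('a::euclidean_space \<Rightarrow> real) \<Rightarrow> 'a set" where
  "dsupp f = {x. \<forall>r>0. 0 < (LINT y:ball x r|lborel. f y)}"

definition Unp :: "'a::euclidean_space set \<Rightarrow> 'a set" where
  "Unp M = {x. \<exists>!y. y \<in> M \<and> (\<forall>z\<in>M. dist x y \<le> dist x z)}"

definition reach_at :: "'a::euclidean_space set \<Rightarrow> 'a \<Rightarrow> ereal" where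
  "reach_at M x = Sup ({0} \<union> {ereal r | r. r > 0 \<and> ball x r \<subseteq> Unp M})"

definition reach :: "'a::euclidean_space set \<Rightarrow> ereal" where
  "reach M = Inf (reach_at M ` M)"

definition alpha :: "('a::euclidean_space \<Rightarrow> real) \<Rightarrow> real" where
  "alpha f = (if reach (dsupp f) = 0 then 1 else 0)"

definition L1_continuous_at :: "(('a::euclidean_space \<Rightarrow> real) \<Rightarrow> real) \<Rightarrow> ('a \<Rightarrow> real) \<Rightarrow> bool" where
  "L1_continuous_at \<Phi> f \<longleftrightarrow>
     (\<forall>e>0. \<exists>d>0. \<forall>g. is_density g \<and> L1_dist f g < d \<longrightarrow> \<bar>\<Phi> g - \<Phi> f\<bar> < e)"

definition consistently_estimable :: "(('a::euclidean_space \<Rightarrow> real) \<Rightarrow> real) \<Rightarrow> bool" where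
  "consistently_estimable \<Phi> \<longleftrightarrow>
     (\<exists>T :: nat \<Rightarrow> (nat \<Rightarrow> 'a) \<Rightarrow> real.
        (\<forall>n. T n \<in> borel_measurable (PiM {..<n} (\<lambda>_. lborel))) \<and>
        (\<forall>f. is_density f \<longrightarrow>
           (\<forall>e>0. (\<lambda>n. measure (PiM {..<n} (\<lambda>_. density lborel (\<lambda>x. ennreal (f x))))
                     {X \<in> space (PiM {..<n} (\<lambda>_. lborel)). e < \<bar>T n X - \<Phi> f\<bar>})
                   \<longlonglongrightarrow> 0)))"

end

theory Submission
  imports Defs
begin

text \<open>
  Every density can be moved by an arbitrarily small amount in \<open>L\<^sup>1\<close> so that its support becomes any
  prescribed regular closed set carrying almost all of its mass: restrict to that set, add a small
  multiple of an everywhere positive density, and renormalise. Taking the whole space gives positive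
  reach. Removing far-out slabs whose widths shrink to zero gives reach zero, since the midplane of
  a slab has two nearest points at a distance of half its width.

  For fixed \<open>n\<close>, the probability \<open>F\<^sub>n(f)\<close> that \<open>T\<^sub>n > 1/2\<close> under the \<open>n\<close>-fold product of \<open>f\<close> is
  \<open>n\<close>-Lipschitz in \<open>L\<^sup>1\<close>. If \<open>T\<^sub>n\<close> were consistent, \<open>F\<^sub>n(f)\<close> would converge to \<open>\<alpha>(f) \<in> {0, 1}\<close>
  everywhere; but the densities are complete in \<open>L\<^sup>1\<close>, and both values are taken densely, so the
  Baire argument produces a density at which \<open>F\<^sub>n\<close> oscillates.
\<close>

subsection \<open>Reach\<close>

lemma not_Unp_if_two_nearest:
  assumes "x \<in> M" "q \<in> M" "x \<noteq> q" "\<And>z. z \<in> M \<Longrightarrow> dist p x \<le> dist p z" "dist p q = dist p x"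
  shows "p \<notin> Unp M"
  using assms unfolding Unp_def by (auto dest!: ex1_implies_ex simp: Ex1_def) metis

text \<open>A ball about \<open>x\<close> of radius larger than \<open>dist x p\<close> would
  contain \<open>p\<close>, so no such radius enters the supremum.\<close>

lemma reach_at_le_dist:
  assumes "p \<notin> Unp M"
  shows "reach_at M x \<le> ereal (dist x p)"
  unfolding reach_at_def
proof (rule Sup_least)
  fix s assume "s \<in> {0} \<union> {ereal r |r. 0 < r \<and> ball x r \<subseteq> Unp M}"
  then consider "s = 0" | r where "s = ereal r" "ball x r \<subseteq> Unp M" by auto
  then show "s \<le> ereal (dist x p)"
  proof cases
    case 1
    then show ?thesis by (simp add: zero_ereal_def)
  next
    case 2
    have "\<not> dist x p < r" using 2(2) assms by (auto simp: subset_iff)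
    with 2(1) show ?thesis by simp
  qed
qed

lemma reach_nonneg: "0 \<le> reach M"
  unfolding reach_def reach_at_def by (intro Inf_greatest) (auto intro: Sup_upper)

text \<open>The point \<open>x\<close> may vary with \<open>e\<close>: it is the infimum over
  \<open>M\<close> that is driven to 0, not the local reach at one point.\<close>

lemma reach_eq_0I:
  assumes "\<And>e. e > 0 \<Longrightarrow> \<exists>x\<in>M. \<exists>p. p \<notin> Unp M \<and> dist x p < e"
  shows "reach M = 0"
proof (rule antisym[OF ereal_le_epsilon2 reach_nonneg])
  fix e :: real assume "0 < e"
  then obtain x p where "x \<in> M" "p \<notin> Unp M" "dist x p < e" using assms[of e] by auto
  then have "reach M \<le> reach_at M x" unfolding reach_def by (intro Inf_lower imageI)
  also have "\<dots> \<le> ereal (dist x p)" by (rule reach_at_le_dist) fact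
  also have "\<dots> \<le> 0 + ereal e" using \<open>dist x p < e\<close> by simp
  finally show "reach M \<le> 0 + ereal e" .
qed

lemma reach_UNIV_pos: "0 < reach (UNIV :: 'a::euclidean_space set)"
proof -
  have "Unp (UNIV :: 'a set) = UNIV"
  proof (intro set_eqI iffI UNIV_I)
    fix x :: 'a
    have "y = x" if "\<forall>z\<in>UNIV. dist x y \<le> dist x z" for y
      using that[THEN bspec, of x] by simp
    then show "x \<in> Unp UNIV" unfolding Unp_def by (intro CollectI ex1I[of _ x]) auto
  qed
  \<comment> \<open>Radius 1 is an arbitrary witness; every positive radius qualifies.\<close>
  then have "ereal 1 \<le> reach_at UNIV x" for x :: 'a
    unfolding reach_at_def by (intro Sup_upper) auto
  then have "ereal 1 \<le> reach (UNIV :: 'a set)"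
    unfolding reach_def by (intro Inf_greatest) auto
  then show ?thesis
    by (metis ereal_less(2) less_le_trans zero_less_one)
qed

subsection \<open>Prescribing the support of a nearby density\<close>

text \<open>If the integral vanished, the integrand would vanish almost everywhere on
  \<open>A\<close>, making \<open>W\<close> a null set; a nonempty open set is not null.\<close>

lemma set_integral_pos_if_open:
  fixes g :: "'a::euclidean_space \<Rightarrow> real"
  assumes "integrable lborel g" "\<And>x. 0 \<le> g x" "open W" "W \<noteq> {}" "W \<subseteq> A" "A \<in> sets borel"
    "\<And>x. x \<in> W \<Longrightarrow> 0 < g x"
  shows "0 < (LINT x:A|lborel. g x)"
proof -
  have int: "integrable lborel (\<lambda>x. indicator A x *\<^sub>R g x)"
    using assms(1,6) by (intro integrable_mult_indicator) auto
  have "(LINT x:A|lborel. g x) \<noteq> 0"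
  proof
    assume "(LINT x:A|lborel. g x) = 0"
    then have "AE x in lborel. indicator A x *\<^sub>R g x = 0"
      using integral_nonneg_eq_0_iff_AE[OF int] assms(2) unfolding set_lebesgue_integral_def by auto
    then have "AE x in lborel. x \<notin> W"
      by eventually_elim (use assms(5,7) in \<open>force simp: indicator_def split: if_splits\<close>)
    then have "W \<in> null_sets lborel" using assms(3) by (subst AE_iff_null_sets) auto
    then have "negligible W"
      by (simp add: null_sets_completionI negligible_iff_null_sets)
    then show False using assms(3,4) open_not_negligible by blast
  qed
  moreover have "0 \<le> (LINT x:A|lborel. g x)"
    unfolding set_lebesgue_integral_def using assms(2) by simp
  ultimately show ?thesis by simp
qed

text \<open>Closedness gives each outside point a ball free of mass. Regularity makes every ball
  about a point of \<open>C\<close> meet \<open>interior C\<close> and hence carry mass; isolated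
  points of \<open>C\<close>, for example, would otherwise drop out of the support.\<close>

lemma dsupp_eqI:
  fixes g :: "'a::euclidean_space \<Rightarrow> real"
  assumes "integrable lborel g" "\<And>x. x \<in> C \<Longrightarrow> 0 < g x" "\<And>x. x \<notin> C \<Longrightarrow> g x = 0"
    "closed C" "C \<subseteq> closure (interior C)"
  shows "dsupp g = C"
proof (intro set_eqI iffI)
  have nn: "0 \<le> g x" for x using assms(2,3)[of x] by (cases "x \<in> C") auto
  fix x assume "x \<in> C"
  show "x \<in> dsupp g" unfolding dsupp_def
  proof (intro CollectI allI impI)
    fix r :: real assume "0 < r"
    have "x \<in> closure (interior C)" using \<open>x \<in> C\<close> assms(5) by auto
    then have "interior C \<inter> ball x r \<noteq> {}"
      using \<open>0 < r\<close> unfolding closure_approachable by (force simp: dist_commute)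
    then show "0 < (LINT y:ball x r|lborel. g y)"
      using interior_subset[of C] assms(1,2) nn
      by (intro set_integral_pos_if_open[of _ "interior C \<inter> ball x r"]) auto
  qed
next
  fix x assume *: "x \<in> dsupp g"
  show "x \<in> C"
  proof (rule ccontr)
    assume "x \<notin> C"
    then obtain r where r: "r > 0" "ball x r \<subseteq> - C"
      using assms(4) by (metis ComplI open_Compl open_contains_ball)
    then have "(LINT y:ball x r|lborel. g y) = (LINT y:ball x r|lborel. 0)"
      using assms(3) by (intro set_lebesgue_integral_cong) auto
    then show False using * r(1) unfolding dsupp_def by (auto simp: set_lebesgue_integral_def)
  qed
qed

lemma L1_dist_nonneg: "0 \<le> L1_dist f g"
  unfolding L1_dist_def by simp

lemma L1_dist_commute: "L1_dist f g = L1_dist g f"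
  unfolding L1_dist_def by (simp add: abs_minus_commute)

lemma L1_dist_triangle:
  assumes "integrable lborel f" "integrable lborel g" "integrable lborel h"
  shows "L1_dist f h \<le> L1_dist f g + L1_dist g h"
proof -
  have "L1_dist f h \<le> (\<integral>x. \<bar>f x - g x\<bar> + \<bar>g x - h x\<bar> \<partial>lborel)"
    unfolding L1_dist_def using assms by (intro integral_mono) auto
  then show ?thesis unfolding L1_dist_def using assms by simp
qed

text \<open>Rescaling moves \<open>g\<close> by exactly the absolute value of \<open>1 - m\<close>,
  and this mass defect is at most \<open>L1_dist f g\<close> because \<open>f\<close> has integral
  1. The triangle inequality then gives the factor 2.\<close>

lemma L1_dist_normalize_le:
  assumes f: "is_density f" and g: "integrable lborel g" "\<And>x. 0 \<le> g x" and "L1_dist f g < 1"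
  defines "m \<equiv> integral\<^sup>L lborel g"
  shows "0 < m" "is_density (\<lambda>x. g x / m)" "L1_dist f (\<lambda>x. g x / m) \<le> 2 * L1_dist f g"
proof -
  have if': "integrable lborel f" "integral\<^sup>L lborel f = 1" using f by (auto simp: is_density_def)
  have "\<bar>1 - m\<bar> = \<bar>\<integral>x. f x - g x \<partial>lborel\<bar>" using if' g(1) by (simp add: m_def)
  also have "\<dots> \<le> L1_dist f g" unfolding L1_dist_def by (rule integral_abs_bound)
  finally have 1: "\<bar>1 - m\<bar> \<le> L1_dist f g" .
  then show m: "0 < m" using assms(4) by linarith
  show "is_density (\<lambda>x. g x / m)" unfolding is_density_def using g m by (auto simp: m_def)
  have "L1_dist g (\<lambda>x. g x / m) = (\<integral>x. g x * (\<bar>m - 1\<bar> / m) \<partial>lborel)"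
    unfolding L1_dist_def
  proof (intro Bochner_Integration.integral_cong refl)
    fix x
    have "g x - g x / m = g x * ((m - 1) / m)" using m by (simp add: field_simps)
    then show "\<bar>g x - g x / m\<bar> = g x * (\<bar>m - 1\<bar> / m)" using m g(2) by (simp add: abs_mult)
  qed
  also have "\<dots> = \<bar>1 - m\<bar>" using m by (simp add: m_def[symmetric] abs_minus_commute)
  finally show "L1_dist f (\<lambda>x. g x / m) \<le> 2 * L1_dist f g"
    using L1_dist_triangle[OF if'(1) g(1), of "\<lambda>x. g x / m"] g(1) 1 by simp
qed

lemma exists_positive_density: "\<exists>f :: 'a::euclidean_space \<Rightarrow> real. is_density f \<and> (\<forall>x. 0 < f x)"
proof -
  obtain h :: "'a \<Rightarrow> real" where h: "h \<in> borel_measurable lborel" "\<And>x. 0 < h x" "integrable lborel h"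
    using sigma_finite_measure.obtain_positive_integrable_function[OF sigma_finite_lborel]
    by blast
  then have "0 < (LINT x:UNIV|lborel. h x)"
    by (intro set_integral_pos_if_open[of _ UNIV]) (auto intro: less_imp_le)
  then have "0 < integral\<^sup>L lborel h" by (simp add: set_lebesgue_integral_def)
  then have "is_density (\<lambda>x. h x / integral\<^sup>L lborel h)" "\<forall>x. 0 < h x / integral\<^sup>L lborel h"
    using h by (auto simp: is_density_def intro: less_imp_le)
  then show ?thesis by blast
qed

lemma exists_near_density_with_dsupp:
  fixes f :: "'a::euclidean_space \<Rightarrow> real"
  assumes f: "is_density f" and "0 < \<delta>" and C: "closed C" "C \<subseteq> closure (interior C)"
    and small: "(LINT x:-C|lborel. f x) < \<delta> / 4" "(LINT x:-C|lborel. f x) < 1 / 4"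
  shows "\<exists>g. is_density g \<and> L1_dist f g < \<delta> \<and> dsupp g = C"
proof -
  have f': "integrable lborel f" "\<And>x. 0 \<le> f x" using f by (auto simp: is_density_def)
  obtain h :: "'a \<Rightarrow> real" where "is_density h" and h: "\<And>x. 0 < h x"
    using exists_positive_density by blast
  then have h1: "integrable lborel h" "integral\<^sup>L lborel h = 1" by (auto simp: is_density_def)
  \<comment> \<open>Together with \<open>small\<close>, this puts \<open>g\<close> within
    \<open>\<delta> / 2\<close> and within 1 of \<open>f\<close>: renormalising relies on the latter
    and at most doubles the distance.\<close>
  define \<epsilon> where "\<epsilon> = min \<delta> 1 / 4"
  have \<epsilon>: "0 < \<epsilon>" "\<epsilon> \<le> \<delta> / 4" "\<epsilon> \<le> 1 / 4" using \<open>0 < \<delta>\<close> by (auto simp: \<epsilon>_def)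
  have mC: "C \<in> sets borel" using C(1) by auto
  define g where "g x = indicator C x *\<^sub>R (f x + \<epsilon> * h x)" for x
  have ig: "integrable lborel g" unfolding g_def
    using f' h1 mC by (intro integrable_mult_indicator) auto
  have gn: "0 \<le> g x" for x using f'(2)[of x] h[of x] \<epsilon> by (auto simp: g_def)
  have ifC: "integrable lborel (\<lambda>x. indicator (-C) x *\<^sub>R f x)"
    using f' mC by (intro integrable_mult_indicator) auto
  have "L1_dist f g \<le> (\<integral>x. indicator (-C) x *\<^sub>R f x + \<epsilon> * h x \<partial>lborel)"
    unfolding L1_dist_def
  proof (intro integral_mono)
    \<comment> \<open>Off \<open>C\<close> the error is \<open>f x\<close>, on \<open>C\<close> it
      is \<open>\<epsilon> * h x\<close>.\<close>
    show "\<bar>f x - g x\<bar> \<le> indicator (-C) x *\<^sub>R f x + \<epsilon> * h x" for x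
      using f'(2)[of x] h[of x] \<epsilon> by (auto simp: g_def indicator_def)
  qed (use f' h1 ig ifC in auto)
  also have "\<dots> = (LINT x:-C|lborel. f x) + \<epsilon>"
    using ifC h1 by (simp add: set_lebesgue_integral_def)
  finally have d: "L1_dist f g < \<delta> / 2" "L1_dist f g < 1" using small \<epsilon> by linarith+
  define m where "m = integral\<^sup>L lborel g"
  note N = L1_dist_normalize_le[OF f ig gn d(2), folded m_def]
  have "dsupp (\<lambda>x. g x / m) = C"
  proof (rule dsupp_eqI[OF _ _ _ C])
    show "0 < g x / m" if "x \<in> C" for x
      using that N(1) f'(2)[of x] h[of x] \<epsilon>(1) by (auto simp: g_def intro!: divide_pos_pos add_nonneg_pos)
    show "integrable lborel (\<lambda>x. g x / m)" using ig by simp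
  qed (simp add: g_def)
  then show ?thesis using N d by (intro exI[of _ "\<lambda>x. g x / m"]) auto
qed

subsection \<open>A closed set of reach zero\<close>

text \<open>The widths tend to 0, which kills the reach; \<open>N\<close> discards the early gaps,
  so that little mass is removed. The 2 in the denominator keeps each gap in the first half of its
  unit interval, hence the gaps apart.\<close>

definition gaps :: "nat \<Rightarrow> real set" where
  "gaps N = (\<Union>n\<in>{N..}. {real n<..<real n + 1 / (real n + 2)})"

lemma gaps_floor:
  assumes "t \<in> gaps N"
  obtains n where "N \<le> n" "real n < t" "t < real n + 1 / (real n + 2)" "t < real n + 1 / 2"
    "\<lfloor>t\<rfloor> = int n"
proof -
  obtain n where n: "N \<le> n" "real n < t" "t < real n + 1 / (real n + 2)"
    using assms unfolding gaps_def by auto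
  have "1 / (real n + 2) \<le> 1 / 2" by (simp add: field_simps)
  with n have "t < real n + 1 / 2" by linarith
  then show ?thesis using n by (intro that[of n]) (auto simp: floor_eq_iff)
qed

text \<open>Each point outside the gaps lies in a closed interval of positive length whose interior
  misses them, and the closure of that open interval contains the point.\<close>

lemma gaps_complement_regular: "- gaps N \<subseteq> closure (interior (- gaps N))"
proof
  fix t assume t: "t \<in> - gaps N"
  define k where "k = \<lfloor>t\<rfloor>"
  have k: "of_int k \<le> t" "t < of_int k + 1" by (auto simp: k_def)
  have "\<exists>a b. a < b \<and> t \<in> {a..b} \<and> {a<..<b} \<inter> gaps N = {}"
  proof (cases "t = of_int k")
    case True
    \<comment> \<open>An integer may be the left end of a gap, so it is approached from the left,
      where the second half of the previous unit interval is free.\<close>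
    have "{t - 1 / 2<..<t} \<inter> gaps N = {}"
    proof (intro equals0I, elim IntE)
      fix s assume "s \<in> {t - 1 / 2<..<t}" "s \<in> gaps N"
      then obtain n where "real n < s" "s < real n + 1 / 2" "t - 1 / 2 < s" "s < t"
        by (auto elim: gaps_floor)
      then have "real_of_int (int n) < of_int k" "real_of_int k < of_int (int n + 1)" using True by auto
      then have "int n < k" "k < int n + 1" by (simp_all only: of_int_less_iff)
      then show False by simp
    qed
    then show ?thesis by (intro exI[of _ "t - 1 / 2"] exI[of _ t]) auto
  next
    case False
    show ?thesis
    proof (cases "k < int N")
      case True
      \<comment> \<open>No gap starts before \<open>N\<close>, so the whole unit interval is
        free.\<close>
      have "{of_int k<..<of_int k + 1} \<inter> gaps N = {}"
      proof (intro equals0I, elim IntE)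
        fix s assume s: "s \<in> {of_int k<..<of_int k + 1}" "s \<in> gaps N"
        from s(2) obtain n where "N \<le> n" "\<lfloor>s\<rfloor> = int n" by (auto elim: gaps_floor)
        moreover have "\<lfloor>s\<rfloor> = k" using s(1) by (auto simp: floor_eq_iff)
        ultimately show False using True by auto
      qed
      then show ?thesis using k
        by (intro exI[of _ "of_int k :: real"] exI[of _ "of_int k + 1 :: real"]) auto
    next
      case F: False
      define m where "m = nat k"
      have m: "N \<le> m" "of_int k = real m" "k = int m" using F by (auto simp: m_def)
      \<comment> \<open>Here the unit interval has a gap at its left end; being no integer,
        \<open>t\<close> lies beyond it, in the free remainder.\<close>
      have ge: "real m + 1 / (real m + 2) \<le> t"
      proof (rule ccontr)
        assume "\<not> ?thesis"
        then have "t \<in> gaps N" using m k False unfolding gaps_def by (auto intro!: bexI[of _ m])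
        with t show False by auto
      qed
      have "{real m + 1 / (real m + 2)<..<real m + 1} \<inter> gaps N = {}"
      proof (intro equals0I, elim IntE)
        fix s assume s: "s \<in> {real m + 1 / (real m + 2)<..<real m + 1}" "s \<in> gaps N"
        from s(2) obtain n where n: "s < real n + 1 / (real n + 2)" "\<lfloor>s\<rfloor> = int n"
          by (auto elim: gaps_floor)
        have "0 < 1 / (real m + 2)" by simp
        then have "real m < s" "s < real m + 1" using s(1) unfolding greaterThanLessThan_iff by linarith+
        then have "\<lfloor>s\<rfloor> = int m" by (auto simp: floor_eq_iff)
        then show False using n s(1) by auto
      qed
      then show ?thesis using k ge m
        by (intro exI[of _ "real m + 1 / (real m + 2)"] exI[of _ "real m + 1"]) auto
    qed
  qed
  then obtain a b where ab: "a < b" "t \<in> {a..b}" "{a<..<b} \<subseteq> - gaps N" by blast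
  then have "{a<..<b} \<subseteq> interior (- gaps N)" by (intro interior_maximal) auto
  then have "closure {a<..<b} \<subseteq> closure (interior (- gaps N))" by (rule closure_mono)
  then show "t \<in> closure (interior (- gaps N))" using ab by auto
qed

lemma open_gaps: "open (gaps N)"
  unfolding gaps_def by auto

definition slabs :: "'a::euclidean_space \<Rightarrow> nat \<Rightarrow> 'a set" where
  "slabs b N = (\<lambda>x. x \<bullet> b) -` gaps N"

lemma open_slabs: "open (slabs b N)"
  unfolding slabs_def by (intro open_vimage open_gaps continuous_intros)

lemma slabs_complement_regular:
  assumes "b \<in> Basis"
  shows "- slabs b N \<subseteq> closure (interior (- slabs b N))"
proof
  fix x assume "x \<in> - slabs b N"
  then have "x \<bullet> b \<in> closure (interior (- gaps N))"
    using gaps_complement_regular by (auto simp: slabs_def)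
  show "x \<in> closure (interior (- slabs b N))"
    unfolding closure_approachable
  proof (intro allI impI)
    fix e :: real assume "0 < e"
    then obtain s where s: "s \<in> interior (- gaps N)" "dist s (x \<bullet> b) < e"
      using \<open>x \<bullet> b \<in> _\<close> unfolding closure_approachable by blast
    have "open ((\<lambda>x. x \<bullet> b) -` interior (- gaps N))"
      by (intro open_vimage open_interior continuous_intros)
    then have "(\<lambda>x. x \<bullet> b) -` interior (- gaps N) \<subseteq> interior (- slabs b N)"
      using interior_subset[of "- gaps N"] by (intro interior_maximal) (auto simp: slabs_def)
    \<comment> \<open>Shifting along the unit vector \<open>b\<close> sets that coordinate to
      \<open>s\<close> and moves \<open>x\<close> by exactly the distance from \<open>s\<close> to
      \<open>x \<bullet> b\<close>.\<close>
    then have "x + (s - x \<bullet> b) *\<^sub>R b \<in> interior (- slabs b N)"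
      using s assms by (auto simp: inner_add_left)
    moreover have "dist (x + (s - x \<bullet> b) *\<^sub>R b) x < e"
      using s assms by (simp add: dist_norm)
    ultimately show "\<exists>y\<in>interior (- slabs b N). dist y x < e" by blast
  qed
qed

lemma reach_slabs_complement:
  fixes b :: "'a::euclidean_space"
  assumes b: "b \<in> Basis"
  shows "reach (- slabs b N) = 0"
proof (rule reach_eq_0I)
  fix e :: real assume "0 < e"
  obtain k :: nat where k: "1 / e < real k" using reals_Archimedean2 by blast
  \<comment> \<open>\<open>n \<ge> N\<close> ensures that the gap after \<open>n\<close> belongs to
    \<open>gaps N\<close>; \<open>n \<ge> k\<close> makes its width less than
    \<open>e\<close>.\<close>
  define n where "n = max N k"
  define w where "w = 1 / (real n + 2)"
  have w: "0 < w" "w < 1" "w < e"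
  proof -
    have "1 / e < real n + 2" using k by (auto simp: n_def)
    then show "w < e" using \<open>0 < e\<close> by (simp add: w_def field_simps)
  qed (auto simp: w_def)
  \<comment> \<open>\<open>x\<close> and \<open>q\<close> lie on opposite walls of one slab, with
    \<open>p\<close> midway between them.\<close>
  define x p q where "x = real n *\<^sub>R b" and "p = (real n + w / 2) *\<^sub>R b" and "q = (real n + w) *\<^sub>R b"
  have ib: "x \<bullet> b = real n" "p \<bullet> b = real n + w / 2" "q \<bullet> b = real n + w"
    using b by (auto simp: x_def p_def q_def)
  have dx: "dist p x = w / 2" and dq: "dist p q = w / 2"
    using b w by (simp_all add: x_def p_def q_def dist_norm flip: scaleR_diff_left)
  have n_not: "real n \<notin> gaps N"
    by (auto elim!: gaps_floor)
  have q_not: "real n + w \<notin> gaps N"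
  proof
    assume "real n + w \<in> gaps N"
    then obtain m where m: "real n + w < real m + 1 / (real m + 2)" "\<lfloor>real n + w\<rfloor> = int m"
      by (auto elim: gaps_floor)
    have "\<lfloor>real n + w\<rfloor> = int n" using w by (auto simp: floor_eq_iff)
    then show False using m by (auto simp: w_def)
  qed
  \<comment> \<open>Distances dominate differences of the \<open>b\<close> coordinate, and no
    coordinate outside the gap is closer to its centre than half the width.\<close>
  have far: "w / 2 \<le> dist p z" if "z \<in> - slabs b N" for z
  proof -
    have "\<not> (real n < z \<bullet> b \<and> z \<bullet> b < real n + w)"
    proof
      assume "real n < z \<bullet> b \<and> z \<bullet> b < real n + w"
      then have "z \<bullet> b \<in> gaps N" unfolding gaps_def w_def n_def by (auto intro!: bexI[of _ "max N k"])
      then show False using that by (auto simp: slabs_def)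
    qed
    then have "w / 2 \<le> \<bar>(p - z) \<bullet> b\<bar>" unfolding inner_diff_left ib by argo
    also have "\<dots> \<le> dist p z" using Basis_le_norm[OF b] by (simp add: dist_norm)
    finally show ?thesis .
  qed
  have "x \<in> - slabs b N" "q \<in> - slabs b N" "x \<noteq> q"
    using n_not q_not ib w by (auto simp: slabs_def)
  then have "p \<notin> Unp (- slabs b N)"
    using far dx dq by (intro not_Unp_if_two_nearest[of x _ q]) auto
  moreover have "dist x p < e" using dx w by (simp add: dist_commute)
  ultimately show "\<exists>x\<in>- slabs b N. \<exists>p. p \<notin> Unp (- slabs b N) \<and> dist x p < e"
    using \<open>x \<in> - slabs b N\<close> by blast
qed

text \<open>Dominated convergence: a fixed point lies in none of the slabs once \<open>N\<close>
  exceeds its \<open>b\<close> coordinate.\<close>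

lemma slabs_mass_tendsto_0:
  assumes "integrable lborel (f :: 'a::euclidean_space \<Rightarrow> real)"
  shows "(\<lambda>N. LINT x:slabs b N|lborel. f x) \<longlonglongrightarrow> 0"
proof -
  have "(\<lambda>N. \<integral>x. indicator (slabs b N) x *\<^sub>R f x \<partial>lborel) \<longlonglongrightarrow> (\<integral>x. 0 \<partial>(lborel :: 'a measure))"
  proof (rule integral_dominated_convergence[where w = "\<lambda>x. \<bar>f x\<bar>"])
    show "AE x in lborel. (\<lambda>N. indicator (slabs b N) x *\<^sub>R f x) \<longlonglongrightarrow> 0"
    proof (rule AE_I2, rule tendsto_eventually)
      fix x
      obtain k :: nat where "x \<bullet> b < real k" using reals_Archimedean2 by blast
      then have "x \<notin> slabs b N" if "N \<ge> k" for N
        using that by (auto simp: slabs_def gaps_def)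
      then show "\<forall>\<^sub>F N in sequentially. indicator (slabs b N) x *\<^sub>R f x = 0"
        by (auto simp: eventually_sequentially intro!: exI[of _ k])
    qed
    show "(\<lambda>x. indicator (slabs b N) x *\<^sub>R f x) \<in> borel_measurable lborel" for N
      using assms open_slabs[of b N] by (intro borel_measurable_scaleR borel_measurable_indicator) auto
  qed (use assms in \<open>auto simp: indicator_def\<close>)
  then show ?thesis by (simp add: set_lebesgue_integral_def)
qed

section \<open>Density of both reach classes and discontinuity of \<open>alpha\<close>\<close>

lemma reach_zero_dense:
  fixes f :: "'a::euclidean_space \<Rightarrow> real"
  assumes "is_density f" "0 < \<delta>"
  shows "\<exists>g. is_density g \<and> L1_dist f g < \<delta> \<and> reach (dsupp g) = 0"
proof -
  obtain b :: 'a where b: "b \<in> Basis" using nonempty_Basis by blast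
  have "(\<lambda>N. LINT x:slabs b N|lborel. f x) \<longlonglongrightarrow> 0"
    using assms by (intro slabs_mass_tendsto_0) (auto simp: is_density_def)
  then have "\<forall>\<^sub>F N in sequentially. (LINT x:slabs b N|lborel. f x) < min \<delta> 1 / 4"
    using assms(2) by (intro order_tendstoD) auto
  then obtain N where "(LINT x:slabs b N|lborel. f x) < min \<delta> 1 / 4"
    by (auto simp: eventually_sequentially)
  then show ?thesis
    using exists_near_density_with_dsupp[OF assms, of "- slabs b N"] open_slabs[of b N]
      slabs_complement_regular[OF b] reach_slabs_complement[OF b, of N]
    by (auto simp: closed_Compl)
qed

lemma reach_pos_dense:
  fixes f :: "'a::euclidean_space \<Rightarrow> real"
  assumes "is_density f" "0 < \<delta>"
  shows "\<exists>g. is_density g \<and> L1_dist f g < \<delta> \<and> reach (dsupp g) > 0"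
  using exists_near_density_with_dsupp[OF assms, of UNIV] reach_UNIV_pos assms(2)
  by (auto simp: set_lebesgue_integral_def)

text \<open>Both values 0 and 1 occur arbitrarily near \<open>f\<close>, and one of them is at
  distance 1 from \<open>alpha f\<close>.\<close>

lemma alpha_not_L1_continuous_at:
  fixes f :: "'a::euclidean_space \<Rightarrow> real"
  assumes "is_density f"
  shows "\<not> L1_continuous_at alpha f"
proof
  assume "L1_continuous_at alpha f"
  then obtain d where d: "d > 0" "\<And>g. is_density g \<Longrightarrow> L1_dist f g < d \<Longrightarrow> \<bar>alpha g - alpha f\<bar> < 1"
    unfolding L1_continuous_at_def by (metis zero_less_one)
  obtain g where "is_density g" "L1_dist f g < d" "alpha g = 1"
    using reach_zero_dense[OF assms d(1)] by (auto simp: alpha_def)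
  moreover obtain h where "is_density h" "L1_dist f h < d" "alpha h = 0"
    using reach_pos_dense[OF assms d(1)] by (auto simp: alpha_def)
  ultimately show False using d(2)[of g] d(2)[of h] by (auto simp: alpha_def split: if_splits)
qed

subsection \<open>Lipschitz dependence of product probabilities on the density\<close>

lemma prob_space_density_lborel:
  assumes "is_density f"
  shows "prob_space (density lborel (\<lambda>x. ennreal (f x)))"
proof (rule prob_spaceI)
  have "emeasure (density lborel (\<lambda>x. ennreal (f x))) UNIV = (\<integral>\<^sup>+x. ennreal (f x) \<partial>lborel)"
    using assms by (subst emeasure_density) (auto simp: is_density_def)
  also have "\<dots> = 1"
    using assms by (subst nn_integral_eq_integral) (auto simp: is_density_def)
  finally show "emeasure (density lborel (\<lambda>x. ennreal (f x))) (space (density lborel (\<lambda>x. ennreal (f x)))) = 1"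
    by simp
qed

abbreviation sample_measure :: "('a::euclidean_space \<Rightarrow> real) \<Rightarrow> nat \<Rightarrow> (nat \<Rightarrow> 'a) measure" where
  "sample_measure f n \<equiv> PiM {..<n} (\<lambda>_. density lborel (\<lambda>x. ennreal (f x)))"

lemma sets_sample_measure: "sets (sample_measure f n) = sets (PiM {..<n} (\<lambda>_. lborel))"
  by (intro sets_PiM_cong) auto

lemma prob_space_sample_measure:
  assumes "is_density f"
  shows "prob_space (sample_measure f n)"
  using prob_space_density_lborel[OF assms] by (intro prob_space_PiM)

text \<open>The one-sample estimate: pointwise \<open>f \<le> g + \<bar>f - g\<bar>\<close>, and
  \<open>h \<le> 1\<close> bounds the contribution of the second term.\<close>

lemma nn_integral_density_le_add_L1_dist:
  assumes f: "is_density f" and g: "is_density g"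
    and h: "h \<in> borel_measurable lborel" "\<And>x. h x \<le> 1"
  shows "(\<integral>\<^sup>+x. h x \<partial>density lborel (\<lambda>x. ennreal (f x)))
    \<le> (\<integral>\<^sup>+x. h x \<partial>density lborel (\<lambda>x. ennreal (g x))) + ennreal (L1_dist f g)"
proof -
  have [measurable]: "f \<in> borel_measurable lborel" "g \<in> borel_measurable lborel"
    using f g by (auto simp: is_density_def)
  note [measurable] = h(1)
  have "(\<integral>\<^sup>+x. h x \<partial>density lborel (\<lambda>x. ennreal (f x))) = (\<integral>\<^sup>+x. ennreal (f x) * h x \<partial>lborel)"
    by (rule nn_integral_density) auto
  also have "\<dots> \<le> (\<integral>\<^sup>+x. ennreal (g x) * h x + ennreal \<bar>f x - g x\<bar> \<partial>lborel)"
  proof (rule nn_integral_mono)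
    fix x
    have "ennreal (f x) * h x \<le> ennreal (g x + \<bar>f x - g x\<bar>) * h x"
      by (intro mult_right_mono ennreal_leI) auto
    also have "\<dots> = ennreal (g x) * h x + ennreal \<bar>f x - g x\<bar> * h x"
      using g by (simp add: is_density_def distrib_right)
    also have "\<dots> \<le> ennreal (g x) * h x + ennreal \<bar>f x - g x\<bar> * 1"
      by (intro add_left_mono mult_left_mono h) auto
    finally show "ennreal (f x) * h x \<le> ennreal (g x) * h x + ennreal \<bar>f x - g x\<bar>" by simp
  qed
  also have "\<dots> = (\<integral>\<^sup>+x. ennreal (g x) * h x \<partial>lborel) + (\<integral>\<^sup>+x. ennreal \<bar>f x - g x\<bar> \<partial>lborel)"
    by (rule nn_integral_add) auto
  also have "(\<integral>\<^sup>+x. ennreal (g x) * h x \<partial>lborel) = (\<integral>\<^sup>+x. h x \<partial>density lborel (\<lambda>x. ennreal (g x)))"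
    by (rule nn_integral_density[symmetric]) auto
  also have "(\<integral>\<^sup>+x. ennreal \<bar>f x - g x\<bar> \<partial>lborel) = ennreal (L1_dist f g)"
    unfolding L1_dist_def using f g by (intro nn_integral_eq_integral) (auto simp: is_density_def)
  finally show ?thesis .
qed

text \<open>Fubini with the last observation integrated first, to set up the induction on the sample
  size.\<close>

lemma nn_integral_sample_measure_Suc:
  assumes f: "is_density f" and h: "h \<in> borel_measurable (PiM {..<Suc n} (\<lambda>_. lborel))"
  shows "(\<integral>\<^sup>+x. h x \<partial>sample_measure f (Suc n))
    = (\<integral>\<^sup>+x. (\<integral>\<^sup>+y. h (x(n := y)) \<partial>density lborel (\<lambda>x. ennreal (f x))) \<partial>sample_measure f n)"
proof -
  interpret prob_space "density lborel (\<lambda>x. ennreal (f x))" by (rule prob_space_density_lborel) fact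
  interpret product_sigma_finite "\<lambda>_::nat. density lborel (\<lambda>x. ennreal (f x))" ..
  have "h \<in> borel_measurable (sample_measure f (Suc n))"
    using h by (simp only: measurable_cong_sets[OF sets_sample_measure refl])
  then show ?thesis
    unfolding lessThan_Suc by (intro product_nn_integral_insert) auto
qed

text \<open>Hybrid argument: \<open>f\<close> is replaced by \<open>g\<close> one factor at a time,
  each replacement costing at most \<open>L1_dist f g\<close>. Functions bounded by 1 stand in for
  events because integrating out a coordinate does not preserve indicators.\<close>

lemma nn_integral_sample_measure_le:
  fixes f g :: "'a::euclidean_space \<Rightarrow> real"
  assumes f: "is_density f" and g: "is_density g"
    and h: "h \<in> borel_measurable (PiM {..<n} (\<lambda>_. lborel))" "\<And>x. h x \<le> 1"
  shows "(\<integral>\<^sup>+x. h x \<partial>sample_measure f n)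
    \<le> (\<integral>\<^sup>+x. h x \<partial>sample_measure g n) + ennreal (real n * L1_dist f g)"
  using h
proof (induction n arbitrary: h)
  case 0
  then show ?case by (simp add: PiM_empty)
next
  case (Suc n)
  let ?P = "\<lambda>f. density lborel (\<lambda>x::'a. ennreal (f x))"
  interpret Pf: prob_space "?P f" by (rule prob_space_density_lborel) fact
  define L where "L = L1_dist f g"
  have L: "0 \<le> L" by (simp add: L_def L1_dist_nonneg)
  have upd: "(\<lambda>(x, y). x(n := y)) \<in> measurable (PiM {..<n} (\<lambda>_. lborel) \<Otimes>\<^sub>M lborel) (PiM {..<Suc n} (\<lambda>_. lborel :: 'a measure))"
    using measurable_add_dim[of n "{..<n}" "\<lambda>_. lborel :: 'a measure"] by (simp add: lessThan_Suc)
  have hm: "(\<lambda>(x, y). h (x(n := y))) \<in> borel_measurable (PiM {..<n} (\<lambda>_. lborel) \<Otimes>\<^sub>M lborel)"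
    using measurable_compose[OF upd Suc.prems(1)] by (simp add: case_prod_beta' fun_upd_def)
  define H where "H q x = (\<integral>\<^sup>+y. h (x(n := y)) \<partial>?P q)" for q x
  have Hm: "H q \<in> borel_measurable (PiM {..<n} (\<lambda>_. lborel))" if "is_density q" for q
  proof -
    interpret prob_space "?P q" by (rule prob_space_density_lborel) fact
    have "(\<lambda>(x, y). h (x(n := y))) \<in> borel_measurable (PiM {..<n} (\<lambda>_. lborel) \<Otimes>\<^sub>M ?P q)"
      using hm by (simp only: measurable_cong_sets[OF sets_pair_measure_cong[OF refl sets_density] refl])
    then show ?thesis unfolding H_def by (intro borel_measurable_nn_integral) simp
  qed
  have H1: "H f x \<le> 1" for x
  proof -
    have "H f x \<le> (\<integral>\<^sup>+y. 1 \<partial>?P f)" unfolding H_def by (intro nn_integral_mono Suc.prems)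
    then show ?thesis using Pf.emeasure_space_1 by simp
  qed
  \<comment> \<open>Membership in the product space gives the measurable section that the one-sample
    estimate requires.\<close>
  have Hle: "H f x \<le> H g x + ennreal L" if "x \<in> space (sample_measure g n)" for x
    unfolding H_def L_def
  proof (rule nn_integral_density_le_add_L1_dist[OF f g])
    have "x \<in> space (PiM {..<n} (\<lambda>_. lborel))" using that by (simp add: space_PiM)
    then show "(\<lambda>y. h (x(n := y))) \<in> borel_measurable lborel"
      using measurable_compose[OF measurable_Pair1' hm] by simp
  qed (rule Suc.prems)
  have "(\<integral>\<^sup>+x. h x \<partial>sample_measure f (Suc n)) = (\<integral>\<^sup>+x. H f x \<partial>sample_measure f n)"
    unfolding H_def by (rule nn_integral_sample_measure_Suc[OF f Suc.prems(1)])
  \<comment> \<open>The first \<open>n\<close> factors are exchanged with \<open>H f\<close> fixed;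
    then the last factor is exchanged inside, turning \<open>H f\<close> into
    \<open>H g\<close>.\<close>
  also have "\<dots> \<le> (\<integral>\<^sup>+x. H f x \<partial>sample_measure g n) + ennreal (real n * L)"
    unfolding L_def by (rule Suc.IH[OF Hm[OF f] H1])
  also have "(\<integral>\<^sup>+x. H f x \<partial>sample_measure g n) \<le> (\<integral>\<^sup>+x. H g x + ennreal L \<partial>sample_measure g n)"
    by (intro nn_integral_mono Hle)
  also have "\<dots> = (\<integral>\<^sup>+x. H g x \<partial>sample_measure g n) + ennreal L"
    using Hm[OF g] prob_space.emeasure_space_1[OF prob_space_sample_measure[OF g]]
    by (subst nn_integral_add) (simp_all add: measurable_cong_sets[OF sets_sample_measure refl])
  also have "(\<integral>\<^sup>+x. H g x \<partial>sample_measure g n) = (\<integral>\<^sup>+x. h x \<partial>sample_measure g (Suc n))"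
    unfolding H_def by (rule nn_integral_sample_measure_Suc[OF g Suc.prems(1), symmetric])
  finally show ?case
    using L by (simp add: L_def[symmetric] add.assoc distrib_right add_right_mono flip: ennreal_plus)
qed

lemma measure_sample_measure_le:
  assumes f: "is_density f" and g: "is_density g" and A: "A \<in> sets (PiM {..<n} (\<lambda>_. lborel))"
  shows "measure (sample_measure f n) A \<le> measure (sample_measure g n) A + real n * L1_dist f g"
proof -
  interpret Sf: prob_space "sample_measure f n" by (rule prob_space_sample_measure) fact
  interpret Sg: prob_space "sample_measure g n" by (rule prob_space_sample_measure) fact
  have A': "A \<in> sets (sample_measure f n)" "A \<in> sets (sample_measure g n)"
    using A by (auto simp: sets_sample_measure)
  have "(indicator A x :: ennreal) \<le> 1" for x by (simp add: indicator_def)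
  then have "emeasure (sample_measure f n) A \<le> emeasure (sample_measure g n) A + ennreal (real n * L1_dist f g)"
    using nn_integral_sample_measure_le[OF f g, of "indicator A" n] A A'
    by simp
  then show ?thesis
    by (simp add: Sf.emeasure_eq_measure Sg.emeasure_eq_measure L1_dist_nonneg flip: ennreal_plus)
qed

subsection \<open>Completeness and the Baire argument\<close>

text \<open>Riesz-Fischer for summable steps: the increments converge absolutely almost everywhere,
  with an integrable majorant. Convergence of distances is what carries bounds along nested balls
  over to the limit.\<close>

lemma density_L1_complete:
  fixes f :: "nat \<Rightarrow> 'a::euclidean_space \<Rightarrow> real"
  assumes f: "\<And>k. is_density (f k)" and sum: "summable (\<lambda>k. L1_dist (f k) (f (Suc k)))"
  obtains h where "is_density h" "\<And>k. (\<lambda>m. L1_dist (f k) (f m)) \<longlonglongrightarrow> L1_dist (f k) h"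
proof -
  have i: "integrable lborel (f k)" and nn: "0 \<le> f k x" and one: "integral\<^sup>L lborel (f k) = 1" for k x
    using f by (auto simp: is_density_def)
  have [measurable]: "f k \<in> borel_measurable borel" for k using f[of k] by (simp add: is_density_def)
  define u where "u k x = f (Suc k) x - f k x" for k x
  have iu: "integrable lborel (u k)" for k using i by (simp add: u_def[abs_def])
  have [measurable]: "u k \<in> borel_measurable borel" for k by (simp add: u_def[abs_def])
  have Lu: "L1_dist (f k) (f (Suc k)) = (\<integral>x. norm (u k x) \<partial>lborel)" for k
    by (simp add: L1_dist_def u_def abs_minus_commute)
  have "(\<integral>\<^sup>+x. (\<Sum>k. ennreal (norm (u k x))) \<partial>lborel) = (\<Sum>k. \<integral>\<^sup>+x. ennreal (norm (u k x)) \<partial>lborel)"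
    by (rule nn_integral_suminf) simp
  also have "\<dots> = (\<Sum>k. ennreal (L1_dist (f k) (f (Suc k))))"
    unfolding Lu using iu by (subst nn_integral_eq_integral) auto
  also have "\<dots> < \<infinity>"
    using sum by (simp add: L1_dist_nonneg ennreal_suminf_neq_top less_top)
  finally have "AE x in lborel. (\<Sum>k. ennreal (norm (u k x))) \<noteq> \<infinity>"
    by (intro nn_integral_PInf_AE) auto
  then have su: "AE x in lborel. summable (\<lambda>k. norm (u k x))"
    by eventually_elim (auto intro: summable_suminf_not_top)
  \<comment> \<open>By telescoping, \<open>w\<close> dominates every \<open>f m\<close> almost
    everywhere.\<close>
  define w where "w x = f 0 x + (\<Sum>k. norm (u k x))" for x
  have iw: "integrable lborel w"
    unfolding w_def using i iu su sum by (intro Bochner_Integration.integrable_add integrable_suminf) (auto simp: Lu)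
  have tele: "f m x = f 0 x + (\<Sum>k<m. u k x)" for m x
    by (induction m) (auto simp: u_def)
  \<comment> \<open>\<open>is_density\<close> asks for nonnegativity at every point;
    \<open>max 0\<close> secures it also on the null set where the limit may fail to exist.\<close>
  define h where "h x = max 0 (lim (\<lambda>m. f m x))" for x
  have hm[measurable]: "h \<in> borel_measurable borel" unfolding h_def by measurable
  have lim: "AE x in lborel. (\<lambda>m. f m x) \<longlonglongrightarrow> h x"
    using su
  proof eventually_elim
    case (elim x)
    then have "summable (\<lambda>k. u k x)" by (rule summable_norm_cancel)
    then have "(\<lambda>m. f 0 x + (\<Sum>k<m. u k x)) \<longlonglongrightarrow> f 0 x + (\<Sum>k. u k x)"
      by (intro tendsto_intros summable_LIMSEQ)
    then have *: "(\<lambda>m. f m x) \<longlonglongrightarrow> f 0 x + (\<Sum>k. u k x)" by (simp flip: tele)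
    moreover from * have "0 \<le> f 0 x + (\<Sum>k. u k x)" by (rule LIMSEQ_le_const) (use nn in auto)
    ultimately show ?case by (simp add: h_def limI)
  qed
  have bound: "AE x in lborel. norm (f m x) \<le> w x" for m
    using su
  proof eventually_elim
    case (elim x)
    have "\<bar>\<Sum>k<m. u k x\<bar> \<le> (\<Sum>k<m. norm (u k x))" by (simp add: sum_abs)
    also have "\<dots> \<le> (\<Sum>k. norm (u k x))" by (rule sum_le_suminf[OF elim]) auto
    finally show ?case using tele[of m x] nn[of 0 x] by (simp add: w_def)
  qed
  have D: "integrable lborel h" "(\<lambda>m. integral\<^sup>L lborel (f m)) \<longlonglongrightarrow> integral\<^sup>L lborel h"
    by (rule integrable_dominated_convergence[OF _ _ iw lim bound] integral_dominated_convergence[OF _ _ iw lim bound]; simp)+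
  have "integral\<^sup>L lborel h = 1" using D(2) by (simp add: one LIMSEQ_const_iff)
  then have dh: "is_density h" using D(1) by (auto simp: is_density_def h_def)
  have "(\<lambda>m. L1_dist (f k) (f m)) \<longlonglongrightarrow> L1_dist (f k) h" for k
    unfolding L1_dist_def
  proof (rule integral_dominated_convergence[where w = "\<lambda>x. w x + w x"])
    show "AE x in lborel. (\<lambda>m. \<bar>f k x - f m x\<bar>) \<longlonglongrightarrow> \<bar>f k x - h x\<bar>"
      using lim by eventually_elim (intro tendsto_intros)
    show "AE x in lborel. norm \<bar>f k x - f m x\<bar> \<le> w x + w x" for m
      using bound[of k] bound[of m] by eventually_elim auto
  qed (use iw in auto)
  with dh show ?thesis by (rule that)
qed

text \<open>The hypothesis says that \<open>Q k\<close> holds at least on a dense open set of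
  densities. The centres of suitably nested balls have summable steps, and their limit lies in all
  of the balls.\<close>

lemma density_Baire:
  fixes Q :: "nat \<Rightarrow> ('a::euclidean_space \<Rightarrow> real) \<Rightarrow> bool" and f0 :: "'a \<Rightarrow> real"
  assumes f0: "is_density f0"
    and dense_open: "\<And>k f \<delta>. is_density f \<Longrightarrow> 0 < \<delta> \<Longrightarrow> \<exists>g r. is_density g \<and> L1_dist f g < \<delta> \<and> 0 < r \<and>
      (\<forall>h. is_density h \<longrightarrow> L1_dist g h < r \<longrightarrow> Q k h)"
  shows "\<exists>h. is_density h \<and> (\<forall>k. Q k h)"
proof -
  \<comment> \<open>A state is a ball: its centre and its radius.\<close>
  define P where "P k s \<longleftrightarrow> is_density (fst s) \<and> 0 < snd s \<and>
      (\<forall>h. is_density h \<longrightarrow> L1_dist (fst s) h < snd s \<longrightarrow> Q k h)" for k and s :: "('a \<Rightarrow> real) \<times> real"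
  \<comment> \<open>At most a quarter for the move and a half for the new radius keep the limit of
    the centres strictly inside every ball.\<close>
  define R where "R s s' \<longleftrightarrow> L1_dist (fst s) (fst s') \<le> snd s / 4 \<and> snd s' \<le> snd s / 2"
    for s s' :: "('a \<Rightarrow> real) \<times> real"
  have "\<exists>s. \<forall>k. P k (s k) \<and> R (s k) (s (Suc k))"
  proof (rule dependent_nat_choice)
    show "\<exists>s. P 0 s" using dense_open[OF f0, of 1 0] by (auto simp: P_def)
    fix s k assume "P k s"
    then obtain g r where g: "is_density g" "L1_dist (fst s) g < snd s / 4" "0 < r"
        "\<forall>h. is_density h \<longrightarrow> L1_dist g h < r \<longrightarrow> Q (Suc k) h"
      using dense_open[of "fst s" "snd s / 4" "Suc k"] by (auto simp: P_def)
    with \<open>P k s\<close> show "\<exists>s'. P (Suc k) s' \<and> R s s'"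
      by (intro exI[of _ "(g, min r (snd s / 2))"]) (auto simp: P_def R_def)
  qed
  then obtain s where s: "\<And>k. P k (s k)" "\<And>k. R (s k) (s (Suc k))" by blast
  define g r where "g k = fst (s k)" and "r k = snd (s k)" for k
  have g: "is_density (g k)" "0 < r k" "\<And>h. is_density h \<Longrightarrow> L1_dist (g k) h < r k \<Longrightarrow> Q k h"
      "L1_dist (g k) (g (Suc k)) \<le> r k / 4" "r (Suc k) \<le> r k / 2" for k
    using s(1)[of k] s(2)[of k] by (auto simp: P_def R_def g_def r_def)
  have ig: "integrable lborel (g k)" for k using g(1)[of k] by (simp add: is_density_def)
  have rk: "r k \<le> r 0 * (1 / 2) ^ k" for k
  proof (induction k)
    case (Suc k)
    then show ?case using g(5)[of k] by simp
  qed simp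
  have "summable (\<lambda>k. r 0 * (1 / 2) ^ k)" by (intro summable_mult summable_geometric) auto
  then have "summable (\<lambda>k. L1_dist (g k) (g (Suc k)))"
  proof (rule summable_comparison_test'[where N = 0])
    fix k
    show "norm (L1_dist (g k) (g (Suc k))) \<le> r 0 * (1 / 2) ^ k"
      using g(4)[of k] g(2)[of k] rk[of k] by (simp add: L1_dist_nonneg)
  qed
  from density_L1_complete[OF g(1) this]
  obtain h where h: "is_density h" "\<And>k. (\<lambda>m. L1_dist (g k) (g m)) \<longlonglongrightarrow> L1_dist (g k) h" by blast
  \<comment> \<open>The term \<open>r (k + j) / 2\<close> closes the induction: in each step the
    distance grows by at most a quarter of the current radius, while half the radius drops by at
    least as much.\<close>
  have near: "L1_dist (g k) (g (k + j)) + r (k + j) / 2 \<le> r k / 2" for k j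
  proof (induction j)
    case 0
    then show ?case by (simp add: L1_dist_def)
  next
    case (Suc j)
    have "L1_dist (g k) (g (k + Suc j)) \<le> L1_dist (g k) (g (k + j)) + L1_dist (g (k + j)) (g (k + Suc j))"
      by (intro L1_dist_triangle ig)
    then show ?case using Suc g(4,5)[of "k + j"] by simp
  qed
  have "Q k h" for k
  proof (rule g(3)[OF h(1)])
    have "L1_dist (g k) h \<le> r k / 2"
    proof (rule LIMSEQ_le_const2[OF h(2)], intro exI[of _ k] allI impI)
      fix m assume "k \<le> m"
      then show "L1_dist (g k) (g m) \<le> r k / 2"
        using near[of k "m - k"] g(2)[of m] by simp
    qed
    then show "L1_dist (g k) h < r k" using g(2)[of k] by simp
  qed
  with h(1) show ?thesis by blast
qed

subsection \<open>Estimability\<close>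

lemma not_consistently_estimable_alpha:
  "\<not> consistently_estimable (alpha :: ('a::euclidean_space \<Rightarrow> real) \<Rightarrow> real)"
proof
  assume "consistently_estimable (alpha :: ('a \<Rightarrow> real) \<Rightarrow> real)"
  then obtain T :: "nat \<Rightarrow> (nat \<Rightarrow> 'a) \<Rightarrow> real" where
    T[measurable]: "\<And>n. T n \<in> borel_measurable (PiM {..<n} (\<lambda>_. lborel))" and
    cons: "\<And>f e. is_density f \<Longrightarrow> 0 < e \<Longrightarrow> (\<lambda>n. measure (sample_measure f n)
             {X \<in> space (PiM {..<n} (\<lambda>_. lborel)). e < \<bar>T n X - alpha f\<bar>}) \<longlonglongrightarrow> 0"
    unfolding consistently_estimable_def by blast
  define A where "A n = {X \<in> space (PiM {..<n} (\<lambda>_. lborel)). 1 / 2 < T n X}" for n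
  have A: "A n \<in> sets (PiM {..<n} (\<lambda>_. lborel))" for n unfolding A_def by measurable
  \<comment> \<open>Any tolerance below 1/2 works: if \<open>alpha f = 0\<close> then
    \<open>A n\<close> lies in the error event, and if \<open>alpha f = 1\<close> its complement
    does.\<close>
  define B where "B c n = {X \<in> space (PiM {..<n} (\<lambda>_. lborel)). 1 / 3 < \<bar>T n X - c\<bar>}" for c n
  have B: "B c n \<in> sets (PiM {..<n} (\<lambda>_. lborel))" for c n unfolding B_def by measurable
  have consB: "(\<lambda>n. measure (sample_measure f n) (B (alpha f) n)) \<longlonglongrightarrow> 0" if "is_density f" for f
    unfolding B_def by (rule cons[OF that]) simp
  define F where "F f n = measure (sample_measure f n) (A n)" for f n
  have lim0: "F f \<longlonglongrightarrow> 0" if "is_density f" "alpha f = 0" for f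
  proof (rule real_tendsto_sandwich[OF _ _ tendsto_const consB[OF that(1)]])
    have "F f n \<le> measure (sample_measure f n) (B (alpha f) n)" for n
    proof -
      interpret prob_space "sample_measure f n" by (rule prob_space_sample_measure) fact
      have "A n \<subseteq> B (alpha f) n" using that(2) by (auto simp: A_def B_def)
      then show ?thesis
        unfolding F_def using B[of "alpha f" n] by (intro finite_measure_mono) (simp_all only: sets_sample_measure)
    qed
    then show "\<forall>\<^sub>F n in sequentially. F f n \<le> measure (sample_measure f n) (B (alpha f) n)"
      by simp
  qed (simp add: F_def)
  have lim1: "F f \<longlonglongrightarrow> 1" if "is_density f" "alpha f = 1" for f
  proof (rule real_tendsto_sandwich[OF _ _ _ tendsto_const])
    have "1 - measure (sample_measure f n) (B (alpha f) n) \<le> F f n" "F f n \<le> 1" for n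
    proof -
      interpret prob_space "sample_measure f n" by (rule prob_space_sample_measure) fact
      have meas: "A n \<in> events" "B (alpha f) n \<in> events"
        using A[of n] B[of "alpha f" n] by (simp_all only: sets_sample_measure)
      have "space (sample_measure f n) \<subseteq> A n \<union> B (alpha f) n"
        unfolding sets_eq_imp_space_eq[OF sets_sample_measure]
      proof
        fix X assume X: "X \<in> space (PiM {..<n} (\<lambda>_. lborel :: 'a measure))"
        have "1 / 2 < T n X \<or> 1 / 3 < \<bar>T n X - 1\<bar>" by argo
        then show "X \<in> A n \<union> B (alpha f) n"
          unfolding A_def B_def that(2) using X by blast
      qed
      then have "prob (space (sample_measure f n)) \<le> prob (A n \<union> B (alpha f) n)"
        using meas by (intro finite_measure_mono sets.Un)
      also have "\<dots> \<le> prob (A n) + prob (B (alpha f) n)"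
        using meas by (rule measure_Un_le)
      finally show "1 - prob (B (alpha f) n) \<le> F f n" unfolding prob_space F_def by linarith
      show "F f n \<le> 1" unfolding F_def by (rule prob_le_1)
    qed
    then show "\<forall>\<^sub>F n in sequentially. 1 - measure (sample_measure f n) (B (alpha f) n) \<le> F f n"
        "\<forall>\<^sub>F n in sequentially. F f n \<le> 1"
      by simp_all
    show "(\<lambda>n. 1 - measure (sample_measure f n) (B (alpha f) n)) \<longlonglongrightarrow> 1"
      using tendsto_diff[OF tendsto_const consB[OF that(1)], of 1] by simp
  qed
  have lip: "\<bar>F f n - F g n\<bar> \<le> real n * L1_dist f g" if "is_density f" "is_density g" for f g n
    using measure_sample_measure_le[OF that A, of n] measure_sample_measure_le[OF that(2,1) A, of n]
    by (simp add: F_def L1_dist_commute[of g f])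
  \<comment> \<open>The summand 1 in \<open>real n + 1\<close> keeps the radius positive at
    \<open>n = 0\<close>, where division by zero would give 0.\<close>
  have near: "\<bar>F g n - F h n\<bar> < 1 / 12"
    if "is_density g" "is_density h" "L1_dist g h < 1 / (12 * (real n + 1))" for g h n
  proof -
    have "\<bar>F g n - F h n\<bar> \<le> (real n + 1) * L1_dist g h"
      using lip[OF that(1,2), of n] L1_dist_nonneg[of g h] by (simp add: distrib_right)
    also have "\<dots> < (real n + 1) * (1 / (12 * (real n + 1)))"
      using that(3) by (intro mult_strict_left_mono) auto
    also have "\<dots> = 1 / 12" by (simp add: field_simps)
    finally show ?thesis .
  qed
  \<comment> \<open>Parity merges both demands into one sequence: all \<open>Q k\<close> together
    force \<open>F h\<close> above 2/3 and below 1/3 infinitely often.\<close>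
  define Q where "Q k h \<longleftrightarrow> (\<exists>n\<ge>k. if even k then 2 / 3 < F h n else F h n < 1 / 3)" for k h
  obtain f0 :: "'a \<Rightarrow> real" where "is_density f0" using exists_positive_density by blast
  then have "\<exists>h. is_density h \<and> (\<forall>k. Q k h)"
  proof (rule density_Baire)
    fix k :: nat and f :: "'a \<Rightarrow> real" and \<delta> :: real
    assume f: "is_density f" "0 < \<delta>"
    obtain g where g: "is_density g" "L1_dist f g < \<delta>" "alpha g = (if even k then 1 else 0)"
      using reach_zero_dense[OF f] reach_pos_dense[OF f] by (cases "even k") (auto simp: alpha_def)
    \<comment> \<open>The bounds 3/4 and 1/4 differ from 2/3 and 1/3 by exactly the 1/12 in
      \<open>near\<close>, so they survive, weakened, on a ball about \<open>g\<close>.\<close>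
    have "\<forall>\<^sub>F n in sequentially. if even k then 3 / 4 < F g n else F g n < 1 / 4"
      using order_tendstoD(1)[OF lim1[OF g(1)], of "3 / 4"] order_tendstoD(2)[OF lim0[OF g(1)], of "1 / 4"] g(3)
      by (cases "even k") auto
    then obtain N where N: "\<And>n. N \<le> n \<Longrightarrow> if even k then 3 / 4 < F g n else F g n < 1 / 4"
      unfolding eventually_sequentially by blast
    define n where "n = max k N"
    have n: "k \<le> n" "if even k then 3 / 4 < F g n else F g n < 1 / 4"
      unfolding n_def by (rule max.cobounded1, rule N, rule max.cobounded2)
    have "Q k h" if "is_density h" "L1_dist g h < 1 / (12 * (real n + 1))" for h
      using near[OF g(1) that, unfolded abs_less_iff] n unfolding Q_def by (intro exI[of _ n]) (auto split: if_splits)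
    then show "\<exists>g r. is_density g \<and> L1_dist f g < \<delta> \<and> 0 < r \<and>
        (\<forall>h. is_density h \<longrightarrow> L1_dist g h < r \<longrightarrow> Q k h)"
      using g by (intro exI[of _ g] exI[of _ "1 / (12 * (real n + 1))"]) auto
  qed
  then obtain h where h: "is_density h" "\<And>k. Q k h" by blast
  show False
  proof (cases "alpha h = 1")
    case True
    then have "\<forall>\<^sub>F n in sequentially. 1 / 3 < F h n" using lim1[OF h(1)] by (intro order_tendstoD) auto
    then obtain N where N: "\<And>n. n \<ge> N \<Longrightarrow> 1 / 3 < F h n" by (auto simp: eventually_sequentially)
    \<comment> \<open>The odd index selects the demand below 1/3 beyond \<open>N\<close>; in the
      other case the even index \<open>2 * N\<close> selects the demand above 2/3.\<close>
    obtain n where "n \<ge> 2 * N + 1" "F h n < 1 / 3" using h(2)[of "2 * N + 1"] by (auto simp: Q_def)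
    then show False using N[of n] by simp
  next
    case False
    then have "alpha h = 0" by (simp add: alpha_def split: if_splits)
    then have "\<forall>\<^sub>F n in sequentially. F h n < 2 / 3" using lim0[OF h(1)] by (intro order_tendstoD) auto
    then obtain N where N: "\<And>n. n \<ge> N \<Longrightarrow> F h n < 2 / 3" by (auto simp: eventually_sequentially)
    obtain n where "n \<ge> 2 * N" "2 / 3 < F h n" using h(2)[of "2 * N"] by (auto simp: Q_def)
    then show False using N[of n] by simp
  qed
qed

theorem theorem3:
  fixes dummy :: "'a::euclidean_space"
  shows "(\<forall>f :: 'a \<Rightarrow> real. is_density f \<and> reach (dsupp f) > 0 \<longrightarrow>
            (\<forall>\<delta>>0. \<exists>g. is_density g \<and> L1_dist f g < \<delta> \<and> reach (dsupp g) = 0))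
       \<and> (\<forall>f :: 'a \<Rightarrow> real. is_density f \<and> reach (dsupp f) = 0 \<longrightarrow>
            (\<forall>\<epsilon>>0. \<exists>g. is_density g \<and> L1_dist f g < \<epsilon> \<and> reach (dsupp g) > 0))
       \<and> (\<forall>f :: 'a \<Rightarrow> real. is_density f \<longrightarrow> \<not> L1_continuous_at alpha f)
       \<and> \<not> consistently_estimable (alpha :: ('a \<Rightarrow> real) \<Rightarrow> real)"
  using reach_zero_dense reach_pos_dense alpha_not_L1_continuous_at not_consistently_estimable_alpha
  by blast

end
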